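(* Let $f:\mathbb{R}\to\mathbb{R}$ be an almost periodic function and let $\alpha\in\mathbb{R}$ be irrational. Then the sequence $\{n\alpha+f(n)\}_{n=1}^\infty$ is dense in $[0,1)$ (mod 1).
   Context: A real sequence $(x_n)_{n\ge1}$ is dense in $[0,1)$ (mod 1) if the set of fractional parts of the $x_n$ is dense in $[0,1)$. In $\{n\alpha+f(n)\}_{n=1}^\infty$ the braces denote the sequence, not fractional part. Almost periodic means (Bohr) uniformly almost periodic: $f$ is continuous and for every $\varepsilon>0$ there is $L(\varepsilon)>0$ such that every interval $I\subset\mathbb{R}$ of length $\ge L(\varepsilon)$ contains a $t$ with $|f(x+t)-f(x)|\le\varepsilon$ for all $x\in\mathbb{R}$. Equivalently (Bohr's theorem), $f$ is a uniform limit on $\mathbb{R}$ of real generalized trigonometric polynomials $\sum_{\tau=1}^{m}(a_\tau\cos(\lambda_\tau x)+b_\tau\sin(\lambda_\tau x))$ with real $a_\tau,b_\tau,\lambda_\tau$. *)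

theory Defs
  imports "HOL-Analysis.Analysis"
begin

text \<open>
  Bohr's uniform almost periodicity. An interval of length at least \<open>L\<close> (of any kind, bounded or
  not) contains an open interval \<open>{a<..<b}\<close> with \<open>b - a \<ge> L\<close>, so quantifying over open intervals
  gives the condition for all intervals, with the same \<open>L\<close>.
\<close>

definition almost_periodic :: "(real \<Rightarrow> real) \<Rightarrow> bool" where
  "almost_periodic f \<longleftrightarrow>
     continuous_on UNIV f \<and>
     (\<forall>\<epsilon>>0. \<exists>L>0. \<forall>a b. b - a \<ge> L \<longrightarrow>
        (\<exists>t\<in>{a<..<b}. \<forall>x. \<bar>f (x + t) - f x\<bar> \<le> \<epsilon>))"

text \<open>Sequences are indexed from 1: the value \<open>x 0\<close> is ignored.\<close>

definition dense_mod_1 :: "(nat \<Rightarrow> real) \<Rightarrow> bool" where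
  "dense_mod_1 x \<longleftrightarrow> {0..<1} \<subseteq> closure ((\<lambda>n. frac (x n)) ` {1..})"

end

theory Submission
  imports Defs
begin

text \<open>
  Suppose that the sequence \<open>x n = n \<alpha> + f n\<close> avoids a neighbourhood of \<open>c\<close> modulo 1. Then
  \<open>x n - c\<close> has a fractional part bounded away from \<open>0\<close> and \<open>1\<close>, so its integer part cannot jump
  under a small perturbation modulo 1. Choose a positive integer \<open>p\<close> that is an almost period of
  \<open>f\<close> and for which \<open>p \<alpha>\<close> is close to an integer \<open>q\<close>. Adding \<open>p\<close> to \<open>n\<close> then raises the integer
  part of \<open>x n - c\<close> by exactly \<open>q\<close>. As \<open>f\<close> is bounded, comparing \<open>x (1 + k p)\<close> with \<open>x 1\<close> shows
  that \<open>k (p \<alpha> - q)\<close> is bounded in \<open>k\<close>, that is \<open>p \<alpha> = q\<close>, and \<open>\<alpha>\<close> is rational.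
\<close>

lemma almost_periodicE:
  assumes "almost_periodic f" "\<epsilon> > 0"
  obtains L where "L > 0"
    "\<And>a. \<exists>t\<in>{a<..<a + L}. \<forall>x. \<bar>f (x + t) - f x\<bar> \<le> \<epsilon>"
proof -
  from assms obtain L where "L > 0" and
    L: "\<And>a b. b - a \<ge> L \<Longrightarrow> \<exists>t\<in>{a<..<b}. \<forall>x. \<bar>f (x + t) - f x\<bar> \<le> \<epsilon>"
    unfolding almost_periodic_def by blast
  show ?thesis
    by (rule that[OF \<open>L > 0\<close>], rule L) simp
qed

text \<open>An almost period for tolerance 1 carries any point into the compact interval
  \<open>{0..L}\<close>, at a cost of at most 1.\<close>

lemma almost_periodic_bounded:
  assumes "almost_periodic f"
  obtains B where "\<And>x. \<bar>f x\<bar> \<le> B"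
proof -
  obtain L where "L > 0" and
    L: "\<And>a. \<exists>t\<in>{a<..<a + L}. \<forall>x. \<bar>f (x + t) - f x\<bar> \<le> 1"
    using almost_periodicE[OF assms zero_less_one] by metis
  have "continuous_on {0..L} f"
    using assms continuous_on_subset unfolding almost_periodic_def by blast
  then have "bounded (f ` {0..L})"
    by (intro compact_imp_bounded compact_continuous_image) auto
  then obtain B where B: "\<And>y. y \<in> {0..L} \<Longrightarrow> \<bar>f y\<bar> \<le> B"
    unfolding bounded_iff by (metis imageI real_norm_def)
  have "\<bar>f x\<bar> \<le> B + 1" for x
  proof -
    obtain t where t: "t \<in> {- x<..<- x + L}" "\<bar>f (x + t) - f x\<bar> \<le> 1"
      using L by blast
    from t(1) have "\<bar>f (x + t)\<bar> \<le> B" by (intro B) auto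
    with t(2) show ?thesis by linarith
  qed
  then show ?thesis by (rule that)
qed

text \<open>One almost period moves both points into a fixed compact interval, where Heine-Cantor
  applies; the two moves cost \<open>e / 4\<close> each.\<close>

lemma almost_periodic_uniformly_continuous:
  assumes "almost_periodic f"
  shows "uniformly_continuous_on UNIV f"
  unfolding uniformly_continuous_on_def
proof (intro allI impI)
  fix e :: real assume "e > 0"
  then have "e / 4 > 0" by simp
  then obtain L where "L > 0" and
    L: "\<And>a. \<exists>t\<in>{a<..<a + L}. \<forall>x. \<bar>f (x + t) - f x\<bar> \<le> e / 4"
    using almost_periodicE[OF assms] by metis
  \<comment> \<open>The margin 1 on each side leaves room for \<open>y + t\<close>: only
    \<open>x + t\<close> is sure to lie in \<open>{0..L}\<close>, and \<open>y\<close> is within 1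
    of \<open>x\<close>.\<close>
  have "continuous_on {-1..L + 1} f"
    using assms continuous_on_subset unfolding almost_periodic_def by blast
  then have "uniformly_continuous_on {-1..L + 1} f"
    by (intro compact_uniformly_continuous) auto
  then obtain d where "d > 0" and
    d: "\<And>x y. x \<in> {-1..L + 1} \<Longrightarrow> y \<in> {-1..L + 1} \<Longrightarrow> dist y x < d \<Longrightarrow> dist (f y) (f x) < e / 4"
    using \<open>e / 4 > 0\<close> unfolding uniformly_continuous_on_def by metis
  have "dist (f y) (f x) < e" if xy: "dist y x < min d 1" for x y
  proof -
    obtain t where t: "t \<in> {- x<..<- x + L}" "\<And>z. \<bar>f (z + t) - f z\<bar> \<le> e / 4"
      using L by blast
    have "dist (f (y + t)) (f (x + t)) < e / 4"
      by (rule d) (use t(1) xy in \<open>auto simp: dist_real_def\<close>)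
    with t(2)[of x] t(2)[of y] \<open>e > 0\<close> show ?thesis
      unfolding dist_real_def by linarith
  qed
  with \<open>d > 0\<close> show "\<exists>d>0. \<forall>x\<in>UNIV. \<forall>x'\<in>UNIV. dist x' x < d \<longrightarrow> dist (f x') (f x) < e"
    by (intro exI[of _ "min d 1"]) auto
qed

lemma abs_diff_less_if_floor_divide_eq:
  fixes a b d :: real
  assumes "d > 0" "\<lfloor>a / d\<rfloor> = \<lfloor>b / d\<rfloor>"
  shows "\<bar>a - b\<bar> < d"
proof -
  have "\<bar>a / d - b / d\<bar> < 1"
    using assms(2) floor_correct[of "a / d"] floor_correct[of "b / d"] by linarith
  with assms(1) show ?thesis
    by (simp add: diff_divide_distrib[symmetric] abs_divide)
qed

text \<open>
  Each \<open>n\<close> is an almost period plus a remainder \<open>s n\<close> in a bounded interval; two indices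
  whose remainders, and whose multiples of \<open>\<alpha>\<close> modulo 1, fall into the same small box
  differ by the desired \<open>p\<close>.
\<close>

lemma almost_periodic_common_period:
  fixes f :: "real \<Rightarrow> real" and \<alpha> :: real
  assumes "almost_periodic f" "\<epsilon> > 0"
  obtains p :: nat and q :: int
  where "p > 0" "\<bar>real p * \<alpha> - of_int q\<bar> < \<epsilon>" "\<And>x. \<bar>f (x + real p) - f x\<bar> < \<epsilon>"
proof -
  have e3: "\<epsilon> / 3 > 0" using assms(2) by simp
  obtain L where "L > 0" and
    L: "\<And>a. \<exists>t\<in>{a<..<a + L}. \<forall>x. \<bar>f (x + t) - f x\<bar> \<le> \<epsilon> / 3"
    using almost_periodicE[OF assms(1) e3] by metis
  obtain d where "d > 0" and d: "\<And>x y. \<bar>y - x\<bar> < d \<Longrightarrow> \<bar>f y - f x\<bar> < \<epsilon> / 3"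
    using almost_periodic_uniformly_continuous[OF assms(1)] e3
    unfolding uniformly_continuous_on_def dist_real_def by (metis UNIV_I)
  have "\<exists>s. \<forall>n::nat. s n \<in> {0<..<L} \<and> (\<forall>x. \<bar>f (x + (real n - s n)) - f x\<bar> \<le> \<epsilon> / 3)"
  proof (intro choice allI)
    fix n :: nat
    obtain t where "t \<in> {real n - L<..<real n - L + L}" "\<forall>x. \<bar>f (x + t) - f x\<bar> \<le> \<epsilon> / 3"
      using L by blast
    then show "\<exists>s. s \<in> {0<..<L} \<and> (\<forall>x. \<bar>f (x + (real n - s)) - f x\<bar> \<le> \<epsilon> / 3)"
      by (intro exI[of _ "real n - t"]) auto
  qed
  then obtain s where s: "\<And>n::nat. s n \<in> {0<..<L}"
    and per: "\<And>n x. \<bar>f (x + (real n - s n)) - f x\<bar> \<le> \<epsilon> / 3"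
    by blast
  \<comment> \<open>Cells of a \<open>d\<close> by \<open>\<epsilon>\<close> grid. Only finitely
    many meet the bounded region, so the pigeonhole principle yields two indices in one
    cell.\<close>
  define box where "box n = (\<lfloor>s n / d\<rfloor>, \<lfloor>frac (real n * \<alpha>) / \<epsilon>\<rfloor>)" for n :: nat
  have "range box \<subseteq> {0..\<lfloor>L / d\<rfloor>} \<times> {0..\<lfloor>1 / \<epsilon>\<rfloor>}"
  proof (rule image_subsetI)
    fix n
    have "0 \<le> s n" "s n \<le> L" using s[of n] by auto
    moreover have "0 \<le> frac (real n * \<alpha>)" "frac (real n * \<alpha>) \<le> 1"
      using frac_lt_1[of "real n * \<alpha>"] by auto
    ultimately show "box n \<in> {0..\<lfloor>L / d\<rfloor>} \<times> {0..\<lfloor>1 / \<epsilon>\<rfloor>}"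
      using \<open>d > 0\<close> \<open>\<epsilon> > 0\<close> unfolding box_def
      by (auto intro!: floor_mono divide_right_mono)
  qed
  then have "finite (range box)"
    by (rule finite_subset) simp
  then have "\<not> inj box"
    using finite_imageD infinite_UNIV_nat by blast
  then obtain m n where "m < n" and box: "box m = box n"
    unfolding inj_def by (metis linorder_neqE_nat)
  show ?thesis
  proof (rule that)
    show "n - m > 0" using \<open>m < n\<close> by simp
    have real_diff: "real (n - m) = real n - real m"
      using \<open>m < n\<close> by (simp add: of_nat_diff)
    have "\<bar>frac (real n * \<alpha>) - frac (real m * \<alpha>)\<bar> < \<epsilon>"
      using box by (intro abs_diff_less_if_floor_divide_eq \<open>\<epsilon> > 0\<close>) (simp add: box_def)
    then show "\<bar>real (n - m) * \<alpha> - of_int (\<lfloor>real n * \<alpha>\<rfloor> - \<lfloor>real m * \<alpha>\<rfloor>)\<bar> < \<epsilon>"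
      unfolding real_diff frac_def by (simp add: algebra_simps)
    have sd: "\<bar>s n - s m\<bar> < d"
      using box by (intro abs_diff_less_if_floor_divide_eq \<open>d > 0\<close>) (simp add: box_def)
    show "\<bar>f (x + real (n - m)) - f x\<bar> < \<epsilon>" for x
    proof -
      \<comment> \<open>The points to compare are now \<open>z + n\<close> and \<open>z + m\<close>.
        They are linked through \<open>z + s n\<close> and \<open>z + s m\<close>: two steps by
        almost periods, and between them one of length below \<open>d\<close>.\<close>
      define z where "z = x - real m"
      have "\<bar>f (z + s n) - f (z + s m)\<bar> < \<epsilon> / 3"
        using sd by (intro d) simp
      moreover have "\<bar>f (z + real n) - f (z + s n)\<bar> \<le> \<epsilon> / 3"
        using per[of "z + s n" n] by simp
      moreover have "\<bar>f (z + real m) - f (z + s m)\<bar> \<le> \<epsilon> / 3"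
        using per[of "z + s m" m] by simp
      ultimately have "\<bar>f (z + real n) - f (z + real m)\<bar> < \<epsilon>"
        by linarith
      then show ?thesis
        by (simp add: z_def real_diff algebra_simps)
    qed
  qed
qed

text \<open>
  The centre is moved away from the given \<open>y\<close>, since for \<open>y = 0\<close> a neighbourhood of \<open>y\<close>
  in the unit interval is only half a neighbourhood modulo 1.
\<close>

lemma not_dense_mod_1E:
  assumes "\<not> dense_mod_1 x"
  obtains \<eta> c where "\<eta> > 0" "\<And>n. n \<ge> 1 \<Longrightarrow> frac (x n - c) \<in> {\<eta>..1 - \<eta>}"
proof -
  from assms obtain y where y: "0 \<le> y" "y < 1"
    and "y \<notin> closure ((\<lambda>n. frac (x n)) ` {1..})"
    unfolding dense_mod_1_def subset_iff by force
  then obtain e where "e > 0" and e: "\<And>n. n \<ge> 1 \<Longrightarrow> \<bar>frac (x n) - y\<bar> \<ge> e"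
    unfolding closure_approachable dist_real_def by (fastforce simp: not_less)
  \<comment> \<open>The avoided interval around \<open>c\<close> runs from \<open>y\<close> to
    \<open>y + 2 * \<eta>\<close>: the first bound keeps it within \<open>e\<close> of
    \<open>y\<close>, the second keeps it below 1, so it does not wrap around.\<close>
  define \<eta> where "\<eta> = min (e / 2) ((1 - y) / 2)"
  define c where "c = y + \<eta>"
  have \<eta>: "\<eta> > 0" "2 * \<eta> \<le> e" "y + 2 * \<eta> \<le> 1"
    using \<open>e > 0\<close> y by (auto simp: \<eta>_def min_def field_simps)
  show ?thesis
  proof (rule that[OF \<eta>(1)])
    fix n :: nat assume "n \<ge> 1"
    let ?r = "frac (x n)"
    have r: "0 \<le> ?r" "?r < 1" by (auto intro: frac_lt_1)
    have xn: "x n = of_int \<lfloor>x n\<rfloor> + ?r" by (simp add: frac_def)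
    consider "?r - c \<ge> \<eta>" | "?r - c \<le> - \<eta>"
      using e[OF \<open>n \<ge> 1\<close>] \<eta> unfolding c_def by linarith
    then show "frac (x n - c) \<in> {\<eta>..1 - \<eta>}"
    proof cases
      case 1
      then have "frac (x n - c) = ?r - c"
        using xn r \<eta> y by (subst frac_unique_iff) (auto simp: c_def algebra_simps frac_def)
      with 1 r y show ?thesis by (auto simp: c_def)
    \<comment> \<open>Here the fractional part of \<open>x n\<close> lies below \<open>c\<close>, so
      subtracting \<open>c\<close> borrows 1 from the integer part.\<close>
    next
      case 2
      have "x n - c - (?r - c + 1) = of_int (\<lfloor>x n\<rfloor> - 1)" using xn by simp
      then have "x n - c - (?r - c + 1) \<in> \<int>" by (metis Ints_of_int)
      moreover have "0 \<le> ?r - c + 1" "?r - c + 1 < 1"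
        using 2 r \<eta> unfolding c_def by linarith+
      ultimately have "frac (x n - c) = ?r - c + 1"
        by (simp add: frac_unique_iff)
      with 2 r y \<eta> show ?thesis
        unfolding atLeastAtMost_iff c_def by linarith
    qed
  qed
qed

theorem proposition1p2:
  fixes f :: "real \<Rightarrow> real" and \<alpha> :: real
  assumes "almost_periodic f"
    and "\<alpha> \<notin> \<rat>"
  shows "dense_mod_1 (\<lambda>n. real n * \<alpha> + f (real n))"
proof (rule ccontr)
  define x where "x n = real n * \<alpha> + f (real n)" for n
  assume "\<not> dense_mod_1 (\<lambda>n. real n * \<alpha> + f (real n))"
  then have "\<not> dense_mod_1 x"
    by (simp add: x_def[abs_def])
  then obtain \<eta> c where "\<eta> > 0" and gap: "\<And>n. n \<ge> 1 \<Longrightarrow> frac (x n - c) \<in> {\<eta>..1 - \<eta>}"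
    using not_dense_mod_1E by blast
  obtain p :: nat and q :: int where "p > 0" and q: "\<bar>real p * \<alpha> - of_int q\<bar> < \<eta>"
    and p: "\<And>x. \<bar>f (x + real p) - f x\<bar> < \<eta>"
    using almost_periodic_common_period[OF assms(1) \<open>\<eta> > 0\<close>] by metis
  obtain B where B: "\<And>x. \<bar>f x\<bar> \<le> B"
    using almost_periodic_bounded[OF assms(1)] by blast
  define m where "m n = \<lfloor>x n - c\<rfloor>" for n
  have x_eq: "x n = c + of_int (m n) + frac (x n - c)" for n
    by (simp add: m_def frac_def)
  have step: "m (n + p) = m n + q" if "n \<ge> 1" for n
  proof -
    have "x (n + p) - x n = real p * \<alpha> + (f (real n + real p) - f (real n))"
      by (simp add: x_def algebra_simps)
    then have "\<bar>x (n + p) - x n - of_int q\<bar> < 2 * \<eta>"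
      using q p[of "real n"] by linarith
    \<comment> \<open>The gap leaves a slack of exactly the perturbation bound
      \<open>2 * \<eta>\<close>, so an integer of absolute value below 1 remains.\<close>
    moreover have "\<bar>frac (x (n + p) - c) - frac (x n - c)\<bar> \<le> 1 - 2 * \<eta>"
      using gap[of n] gap[of "n + p"] that by auto
    ultimately have "\<bar>real_of_int (m (n + p) - m n - q)\<bar> < 1"
      using x_eq[of n] x_eq[of "n + p"] by simp
    then show ?thesis by linarith
  qed
  \<comment> \<open>The progression starts at 1 because the gap is only known for positive
    indices.\<close>
  have iter: "m (1 + k * p) = m 1 + int k * q" for k
  proof (induction k)
    case (Suc k)
    have "m (1 + Suc k * p) = m (1 + k * p) + q"
      using step[of "1 + k * p"] by (simp add: algebra_simps)
    with Suc show ?case by (simp add: algebra_simps)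
  qed simp
  have bounded: "real k * \<bar>real p * \<alpha> - of_int q\<bar> \<le> 2 * B + 1" for k
  proof -
    let ?n = "1 + k * p"
    have "x ?n - x 1 = real k * of_int q + (frac (x ?n - c) - frac (x 1 - c))"
      using x_eq[of ?n] x_eq[of 1] iter[of k] by simp
    moreover have "x ?n - x 1 = real k * (real p * \<alpha>) + (f (real ?n) - f 1)"
      by (simp add: x_def algebra_simps)
    ultimately have "real k * (real p * \<alpha> - of_int q)
        = (frac (x ?n - c) - frac (x 1 - c)) - (f (real ?n) - f 1)"
      by (simp add: algebra_simps)
    moreover have "\<bar>frac (x ?n - c) - frac (x 1 - c)\<bar> \<le> 1"
      using frac_ge_0[of "x ?n - c"] frac_lt_1[of "x ?n - c"]
        frac_ge_0[of "x 1 - c"] frac_lt_1[of "x 1 - c"] by linarith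
    ultimately have "\<bar>real k * (real p * \<alpha> - of_int q)\<bar> \<le> 2 * B + 1"
      using B[of "real ?n"] B[of 1] by linarith
    then show ?thesis by (simp add: abs_mult)
  qed
  have "real p * \<alpha> = of_int q"
  proof (rule ccontr)
    assume "real p * \<alpha> \<noteq> of_int q"
    then obtain k where "2 * B + 1 < real k * \<bar>real p * \<alpha> - of_int q\<bar>"
      using reals_Archimedean3[of "\<bar>real p * \<alpha> - of_int q\<bar>"] by auto
    with bounded[of k] show False by linarith
  qed
  with \<open>p > 0\<close> have "\<alpha> = of_int q / of_nat p"
    by (simp add: field_simps)
  then have "\<alpha> \<in> \<rat>" by simp
  with assms(2) show False ..
qed

end
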